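(* Assume that the Levin-type sequence transformation $\mathcal{T}^{(k)}$ has characteristic polynomials $\Pi^{(k)}_n(z)=\sum_{j=0}^k\lambda^{(k)}_{n,j}z^j$ with alternating coefficients, i.e. $\lambda^{(k)}_{n,j}=(-1)^j|\lambda^{(k)}_{n,j}|/\tau_k$ with $|\tau_k|=1$ for all $n\in\mathbb{N}_0$ and $k\in\mathbb{N}$ (and $0\le j\le k$). The sequence $\{\omega_n\}$ of nonzero elements of $\mathbb{K}$ is assumed to be alternating and to satisfy $\omega_{n+1}/\omega_n<0$ for all $n\in\mathbb{N}_0$. Then $\boldsymbol\Gamma^{(k)}_n(\mathcal{T})=1$. Hence, the transformation $\mathcal{T}$ is stable along all paths for such remainder estimates $\{\omega_n\}$.
   Context: $\mathbb{K}$ denotes $\mathbb{R}$ or $\mathbb{C}$; $\mathbb{N}=\{1,2,\dots\}$, $\mathbb{N}_0=\mathbb{N}\cup\{0\}$. A coefficient set of order $k$ is a family $\lambda^{(k)}_{n,j}\in\mathbb{K}$ ($n\in\mathbb{N}_0$, $0\le j\le k$) with $\lambda^{(k)}_{n,k}\neq0$ for all $n$. The corresponding Levin-type sequence transformation of order $k$ maps a sequence $\{s_n\}$ in $\mathbb{K}$ and a sequence $\{\omega_n\}$ of nonzero elements of $\mathbb{K}$ (remainder estimates), with $\sum_{j=0}^k\lambda^{(k)}_{n,j}/\omega_{n+j}\neq0$, to $$\mathcal{T}^{(k)}_n=\frac{\sum_{j=0}^k\lambda^{(k)}_{n,j}\,s_{n+j}/\omega_{n+j}}{\sum_{j=0}^k\lambda^{(k)}_{n,j}/\omega_{n+j}}=\sum_{j=0}^k\gamma^{(k)}_{n,j}s_{n+j},\qquad\gamma^{(k)}_{n,j}=\frac{\lambda^{(k)}_{n,j}}{\omega_{n+j}}\left[\sum_{j'=0}^k\frac{\lambda^{(k)}_{n,j'}}{\omega_{n+j'}}\right]^{-1}.$$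 $\mathcal{T}$ denotes the family of all $\mathcal{T}^{(k)}$, $k\in\mathbb{N}$. The stability indices (for the given $\{\omega_n\}$) are $\boldsymbol\Gamma^{(k)}_n(\mathcal{T})=\sum_{j=0}^k|\gamma^{(k)}_{n,j}|$. A path is a sequence of index pairs $(n_\ell,k_\ell)$ such that for each $\ell$ either [$n_\ell>n_{\ell-1}$ and $k_\ell\ge k_{\ell-1}$] or [$n_\ell\ge n_{\ell-1}$ and $k_\ell>k_{\ell-1}$]; $\mathcal{T}$ is stable along the path if $\lim_{\ell\to\infty}\boldsymbol\Gamma^{(k_\ell)}_{n_\ell}(\mathcal{T})$ exists and is finite. *)

theory Defs
  imports "HOL-Analysis.Analysis" "HOL-Computational_Algebra.Polynomial"
begin

text \<open>
  The ground field is a type of class \<^class>\<open>real_normed_field\<close>. Its instances include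
  \<^typ>\<open>real\<close> and \<^typ>\<open>complex\<close>; as the norm is multiplicative, these are, up to isomorphism,
  the only ones.

  A coefficient family \<open>L\<close> assigns to \<open>k\<close>, \<open>n\<close>, \<open>j\<close> the coefficient \<open>L k n j\<close>, written
  $\lambda^{(k)}_{n,j}$ in the literature. Only orders \<open>k \<ge> 1\<close> and indices \<open>j \<le> k\<close> are meaningful.
\<close>

definition coefficient_set :: "nat \<Rightarrow> (nat \<Rightarrow> nat \<Rightarrow> 'a::real_normed_field) \<Rightarrow> bool" where
  "coefficient_set k l \<longleftrightarrow> (\<forall>n. l n k \<noteq> 0)"

definition levin_denom ::
    "nat \<Rightarrow> (nat \<Rightarrow> nat \<Rightarrow> 'a::real_normed_field) \<Rightarrow> (nat \<Rightarrow> 'a) \<Rightarrow> nat \<Rightarrow> 'a" where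
  "levin_denom k l \<omega> n = (\<Sum>j\<le>k. l n j / \<omega> (n + j))"

definition levin_transform ::
    "nat \<Rightarrow> (nat \<Rightarrow> nat \<Rightarrow> 'a::real_normed_field) \<Rightarrow> (nat \<Rightarrow> 'a) \<Rightarrow> (nat \<Rightarrow> 'a) \<Rightarrow> nat \<Rightarrow> 'a" where
  "levin_transform k l \<omega> s n = (\<Sum>j\<le>k. l n j * s (n + j) / \<omega> (n + j)) / levin_denom k l \<omega> n"

definition levin_weight ::
    "nat \<Rightarrow> (nat \<Rightarrow> nat \<Rightarrow> 'a::real_normed_field) \<Rightarrow> (nat \<Rightarrow> 'a) \<Rightarrow> nat \<Rightarrow> nat \<Rightarrow> 'a" where
  "levin_weight k l \<omega> n j = l n j / \<omega> (n + j) * inverse (levin_denom k l \<omega> n)"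

lemma levin_transform_eq_weights:
  "levin_transform k l \<omega> s n = (\<Sum>j\<le>k. levin_weight k l \<omega> n j * s (n + j))"
  unfolding levin_transform_def levin_weight_def
  by (simp add: divide_inverse sum_distrib_left sum_distrib_right mult_ac)

text \<open>
  If the denominator vanishes, the transformation is undefined, whereas here all weights, and
  hence the stability index, become 0. In particular a nonzero stability index entails that
  the denominator does not vanish.
\<close>

definition stability_index ::
    "nat \<Rightarrow> (nat \<Rightarrow> nat \<Rightarrow> 'a::real_normed_field) \<Rightarrow> (nat \<Rightarrow> 'a) \<Rightarrow> nat \<Rightarrow> real" where
  "stability_index k l \<omega> n = (\<Sum>j\<le>k. norm (levin_weight k l \<omega> n j))"

lemma levin_denom_nonzero:
  "stability_index k l \<omega> n \<noteq> 0 \<Longrightarrow> levin_denom k l \<omega> n \<noteq> 0"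
  by (auto simp: stability_index_def levin_weight_def)

definition levin_char_poly ::
    "nat \<Rightarrow> (nat \<Rightarrow> nat \<Rightarrow> 'a::real_normed_field) \<Rightarrow> nat \<Rightarrow> 'a poly" where
  "levin_char_poly k l n = (\<Sum>j\<le>k. monom (l n j) j)"

definition alternating_coeffs :: "'a::real_normed_field \<Rightarrow> 'a poly \<Rightarrow> bool" where
  "alternating_coeffs t p \<longleftrightarrow>
     (\<forall>j\<le>degree p. coeff p j = (-1) ^ j * of_real (norm (coeff p j)) / t)"

lemma coeff_levin_char_poly:
  "coeff (levin_char_poly k l n) j = (if j \<le> k then l n j else 0)"
  by (simp add: levin_char_poly_def coeff_sum)

lemma alternating_coeffs_levin_char_poly:
  "alternating_coeffs t (levin_char_poly k l n) \<longleftrightarrow>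
     (\<forall>j\<le>k. l n j = (-1) ^ j * of_real (norm (l n j)) / t)"
proof -
  let ?p = "levin_char_poly k l n"
  have "alternating_coeffs t ?p \<longleftrightarrow>
      (\<forall>j. coeff ?p j = (-1) ^ j * of_real (norm (coeff ?p j)) / t)"
    unfolding alternating_coeffs_def
    by (metis coeff_eq_0 div_0 linorder_not_le mult_zero_right norm_zero of_real_0)
  then show ?thesis
    by (auto simp: coeff_levin_char_poly)
qed

text \<open>
  A path is an infinite sequence of index pairs \<open>(n, k)\<close>, where \<open>n \<ge> 0\<close> and \<open>k \<ge> 1\<close>.
\<close>

definition levin_path :: "(nat \<Rightarrow> nat \<times> nat) \<Rightarrow> bool" where
  "levin_path P \<longleftrightarrow>
     (\<forall>i. snd (P i) \<ge> 1) \<and>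
     (\<forall>i. (fst (P (Suc i)) > fst (P i) \<and> snd (P (Suc i)) \<ge> snd (P i)) \<or>
          (fst (P (Suc i)) \<ge> fst (P i) \<and> snd (P (Suc i)) > snd (P i)))"

definition stable_along ::
    "(nat \<Rightarrow> nat \<Rightarrow> nat \<Rightarrow> 'a::real_normed_field) \<Rightarrow> (nat \<Rightarrow> 'a) \<Rightarrow> (nat \<Rightarrow> nat \<times> nat) \<Rightarrow> bool" where
  "stable_along L \<omega> P \<longleftrightarrow>
     convergent (\<lambda>i. stability_index (snd (P i)) (L (snd (P i))) \<omega> (fst (P i)))"

end

theory Submission
  imports Defs
begin

text \<open>
  The signs of the coefficients and of the remainder estimates cancel, so for fixed \<open>n\<close> all
  summands of the denominator have the same phase. Hence the triangle inequality for the
  denominator is an equality.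
\<close>

lemma norm_sum_eq_if_same_phase:
  fixes f :: "'b \<Rightarrow> 'a::real_normed_field"
  assumes "norm c = 1" and "\<And>i. i \<in> A \<Longrightarrow> f i = c * of_real (norm (f i))"
  shows "norm (sum f A) = (\<Sum>i\<in>A. norm (f i))"
proof -
  have "sum f A = c * of_real (\<Sum>i\<in>A. norm (f i))"
    using assms(2) by (simp add: sum_distrib_left)
  then show ?thesis
    \<comment> \<open>Keeping the sum under a single \<open>of_real\<close> lets its norm be read
      off as the absolute value of a nonnegative real.\<close>
    using assms(1) by (simp add: norm_mult sum_nonneg del: of_real_sum)
qed

text \<open>A negative real ratio equals minus its own norm, so the product of \<open>j\<close>
  consecutive ratios telescopes to \<open>(-1) ^ j\<close> times a quotient of norms. The phase of
  \<open>\<omega> n\<close> itself stays arbitrary, hence the formula relative to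
  \<open>\<omega> n\<close>.\<close>

lemma alternating_sequence_shift:
  fixes \<omega> :: "nat \<Rightarrow> 'a::real_normed_field"
  assumes nz: "\<And>n. \<omega> n \<noteq> 0"
    and alt: "\<And>n. \<exists>r::real. r < 0 \<and> \<omega> (Suc n) / \<omega> n = of_real r"
  shows "\<omega> (n + j) = (-1) ^ j * of_real (norm (\<omega> (n + j)) / norm (\<omega> n)) * \<omega> n"
proof (induction j)
  case 0
  then show ?case
    using nz by simp
next
  case (Suc j)
  obtain r :: real where r: "r < 0" "\<omega> (Suc (n + j)) = of_real r * \<omega> (n + j)"
    using alt[of "n + j"] nz[of "n + j"] by (auto simp: field_simps)
  \<comment> \<open>As \<open>r\<close> is negative, its absolute value is \<open>- r\<close>; this
    supplies the extra factor -1 of the induction step.\<close>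
  have "norm (\<omega> (Suc (n + j))) = - r * norm (\<omega> (n + j))"
    using r by (simp add: norm_mult)
  moreover have "\<omega> (Suc (n + j))
      = of_real r * ((-1) ^ j * of_real (norm (\<omega> (n + j)) / norm (\<omega> n)) * \<omega> n)"
    using r(2) Suc.IH by simp
  ultimately show ?case
    by (simp add: mult_ac)
qed

lemma stability_index_eq_1:
  fixes l :: "nat \<Rightarrow> nat \<Rightarrow> 'a::real_normed_field"
  assumes lead: "coefficient_set k l"
    and t: "norm t = 1"
    and altl: "alternating_coeffs t (levin_char_poly k l n)"
    and nz: "\<And>n. \<omega> n \<noteq> 0"
    and alt: "\<And>n. \<exists>r::real. r < 0 \<and> \<omega> (Suc n) / \<omega> n = of_real r"
  shows "stability_index k l \<omega> n = 1"
proof -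
  define f where "f j = l n j / \<omega> (n + j)" for j
  \<comment> \<open>The common phase: \<open>1 / t\<close> comes from the coefficients, and the norm
    of \<open>\<omega> n\<close> divided by \<open>\<omega> n\<close> from the remainder estimates.
    The factors \<open>(-1) ^ j\<close> cancel in the quotient \<open>f j\<close>, so
    \<open>c\<close> does not depend on \<open>j\<close>.\<close>
  define c where "c = of_real (norm (\<omega> n)) / (t * \<omega> n)"
  have "norm c = 1"
    using t nz by (simp add: c_def norm_divide norm_mult)
  moreover have "f j = c * of_real (norm (f j))" if "j \<in> {..k}" for j
  proof -
    have "l n j = (-1) ^ j * of_real (norm (l n j)) / t"
      using altl that by (simp add: alternating_coeffs_levin_char_poly)
    then have "f j = ((-1) ^ j * of_real (norm (l n j)) / t)
        / ((-1) ^ j * of_real (norm (\<omega> (n + j)) / norm (\<omega> n)) * \<omega> n)"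
      using alternating_sequence_shift[of \<omega> n j, OF nz alt] by (simp only: f_def)
    also have "\<dots> = c * of_real (norm (f j))"
      using nz t by (simp add: c_def f_def norm_divide field_simps)
    finally show ?thesis .
  qed
  ultimately have "norm (sum f {..k}) = (\<Sum>j\<le>k. norm (f j))"
    by (rule norm_sum_eq_if_same_phase)
  \<comment> \<open>The leading coefficient is nonzero, so the summand \<open>j = k\<close> is
    positive. This excludes a vanishing denominator, for which the index would take the default
    value 0.\<close>
  moreover have "0 < (\<Sum>j\<le>k. norm (f j))"
  proof (rule sum_pos2)
    show "0 < norm (f k)"
      using lead nz by (simp add: f_def coefficient_set_def)
  qed auto
  moreover have "stability_index k l \<omega> n = (\<Sum>j\<le>k. norm (f j)) / norm (sum f {..k})"
    by (simp add: stability_index_def levin_weight_def levin_denom_def f_def norm_mult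
        norm_inverse divide_inverse sum_distrib_right)
  ultimately show ?thesis
    by simp
qed

theorem theorem17:
  fixes L :: "nat \<Rightarrow> nat \<Rightarrow> nat \<Rightarrow> 'a::real_normed_field"
    and \<tau> :: "nat \<Rightarrow> 'a"
    and \<omega> :: "nat \<Rightarrow> 'a"
  assumes coeffs: "\<And>k. k \<ge> 1 \<Longrightarrow> coefficient_set k (L k)"
    and tau: "\<And>k. k \<ge> 1 \<Longrightarrow> norm (\<tau> k) = 1"
    and alternating: "\<And>k n. k \<ge> 1 \<Longrightarrow> alternating_coeffs (\<tau> k) (levin_char_poly k (L k) n)"
    and omega_nonzero: "\<And>n. \<omega> n \<noteq> 0"
    and omega_alternating: "\<And>n. \<exists>r::real. r < 0 \<and> \<omega> (Suc n) / \<omega> n = of_real r"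
  shows "(\<forall>k\<ge>1. \<forall>n. stability_index k (L k) \<omega> n = 1) \<and>
         (\<forall>P. levin_path P \<longrightarrow> stable_along L \<omega> P)"
proof (intro conjI allI impI)
  show index: "stability_index k (L k) \<omega> n = 1" if "k \<ge> 1" for k n
    by (rule stability_index_eq_1)
      (use that coeffs tau alternating omega_nonzero omega_alternating in blast)+
  \<comment> \<open>Every order on a path is at least 1, so the indices along it form the constant
    sequence 1.\<close>
  show "stable_along L \<omega> P" if "levin_path P" for P
    using that index by (simp add: stable_along_def levin_path_def convergent_const)
qed

end
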